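(* Let $I\in\mathbb{S}$ be fixed and $2<p<\infty$. Let $f\in L^2(\mathbb{R},\mathbb{H})$ be a unit vector, $U$ an open set of $\mathbb{R}^2$ and $\varepsilon\ge0$ such that $$\int_U|\mathcal{V}_\varphi f(x,\omega)|^2\,dx\,d\omega\ge1-\varepsilon.$$ Then $$|U|\ge c_p(1-\varepsilon)^{\frac{p}{p-2}},$$ where $|U|$ denotes the Lebesgue measure of $U$ and $c_p=\left(\frac{2^{p+1}}{p}\right)^{-\frac{2}{p-2}}$.
   Context: $\mathbb{H}$ is the algebra of real quaternions, $\mathbb{S}=\{q\in\mathbb{H}:q^2=-1\}$. $L^2(\mathbb{R},\mathbb{H})$ is the space of square integrable $\mathbb{H}$-valued functions with norm $\|f\|^2=\int_{\mathbb{R}}|f(t)|^2dt$; a unit vector is an $f$ with $\|f\|=1$. The quaternionic Segal-Bargmann transform with parameter $\nu=2\pi$ is $\mathcal{B}^S_{\mathbb{H}}(f)(q)=\int_{\mathbb{R}}2^{3/4}e^{-\pi(q^2+t^2)+2\pi\sqrt2\,qt}f(t)\,dt$, $q\in\mathbb{H}$. Let $\varphi(t)=2^{1/4}e^{-\pi t^2}$. For $I\in\mathbb{S}$ fixed, the 1D quaternion short-time Fourier transform (QSTFT) of $f\in L^2(\mathbb{R},\mathbb{H})$ with window $\varphi$ is $$\mathcal{V}_\varphi f(x,\omega)=e^{-I\pi x\omega}\,\mathcal{B}^S_{\mathbb{H}}(f)\!\left(\frac{\bar q}{\sqrt2}\right)e^{-\frac{\pi|q|^2}{2}},\qquad q=x+I\omega,\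 (x,\omega)\in\mathbb{R}^2.$$
   Formalization: The condition ε ≤ 1 is added: for ε > 1 the power (1−ε)^{p/(p−2)} has a negative base and is in general undefined, and where it is defined the claim can fail (p = 4, ε = 2, U empty). *)

theory Defs
  imports "HOL-Analysis.Analysis"
begin

section \<open>The algebra of real quaternions\<close>

text \<open>\<open>Quat a b c d\<close> stands for $a + bi + cj + dk$.\<close>

datatype quat = Quat (qRe: real) (qIm1: real) (qIm2: real) (qIm3: real)

lemma quat_eq_iff:
  "x = y \<longleftrightarrow> qRe x = qRe y \<and> qIm1 x = qIm1 y \<and> qIm2 x = qIm2 y \<and> qIm3 x = qIm3 y"
  by (cases x; cases y) auto

instantiation quat :: ring_1
begin

definition zero_quat_def: "0 = Quat 0 0 0 0"

definition one_quat_def: "1 = Quat 1 0 0 0"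

definition plus_quat_def:
  "x + y = Quat (qRe x + qRe y) (qIm1 x + qIm1 y) (qIm2 x + qIm2 y) (qIm3 x + qIm3 y)"

definition minus_quat_def:
  "x - y = Quat (qRe x - qRe y) (qIm1 x - qIm1 y) (qIm2 x - qIm2 y) (qIm3 x - qIm3 y)"

definition uminus_quat_def:
  "- x = Quat (- qRe x) (- qIm1 x) (- qIm2 x) (- qIm3 x)"

definition times_quat_def:
  "x * y = Quat
     (qRe x * qRe y - qIm1 x * qIm1 y - qIm2 x * qIm2 y - qIm3 x * qIm3 y)
     (qRe x * qIm1 y + qIm1 x * qRe y + qIm2 x * qIm3 y - qIm3 x * qIm2 y)
     (qRe x * qIm2 y - qIm1 x * qIm3 y + qIm2 x * qRe y + qIm3 x * qIm1 y)
     (qRe x * qIm3 y + qIm1 x * qIm2 y - qIm2 x * qIm1 y + qIm3 x * qRe y)"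

instance
  by standard
    (auto simp: zero_quat_def one_quat_def plus_quat_def minus_quat_def uminus_quat_def
       times_quat_def quat_eq_iff algebra_simps)

end

lemma quat_sel_simps [simp]:
  "qRe 0 = 0" "qIm1 0 = 0" "qIm2 0 = 0" "qIm3 0 = 0"
  "qRe 1 = 1" "qIm1 1 = 0" "qIm2 1 = 0" "qIm3 1 = 0"
  "qRe (x + y) = qRe x + qRe y" "qIm1 (x + y) = qIm1 x + qIm1 y"
  "qIm2 (x + y) = qIm2 x + qIm2 y" "qIm3 (x + y) = qIm3 x + qIm3 y"
  "qRe (x - y) = qRe x - qRe y" "qIm1 (x - y) = qIm1 x - qIm1 y"
  "qIm2 (x - y) = qIm2 x - qIm2 y" "qIm3 (x - y) = qIm3 x - qIm3 y"
  "qRe (- x) = - qRe x" "qIm1 (- x) = - qIm1 x"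
  "qIm2 (- x) = - qIm2 x" "qIm3 (- x) = - qIm3 x"
  by (simp_all add: zero_quat_def one_quat_def plus_quat_def minus_quat_def uminus_quat_def)

lemma quat_sel_mult [simp]:
  "qRe (x * y) = qRe x * qRe y - qIm1 x * qIm1 y - qIm2 x * qIm2 y - qIm3 x * qIm3 y"
  "qIm1 (x * y) = qRe x * qIm1 y + qIm1 x * qRe y + qIm2 x * qIm3 y - qIm3 x * qIm2 y"
  "qIm2 (x * y) = qRe x * qIm2 y - qIm1 x * qIm3 y + qIm2 x * qRe y + qIm3 x * qIm1 y"
  "qIm3 (x * y) = qRe x * qIm3 y + qIm1 x * qIm2 y - qIm2 x * qIm1 y + qIm3 x * qRe y"
  by (simp_all add: times_quat_def)

instantiation quat :: real_algebra_1
begin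

definition scaleR_quat_def:
  "r *\<^sub>R x = Quat (r * qRe x) (r * qIm1 x) (r * qIm2 x) (r * qIm3 x)"

instance
  by standard (auto simp: scaleR_quat_def quat_eq_iff algebra_simps)

end

lemma quat_sel_scaleR [simp]:
  "qRe (r *\<^sub>R x) = r * qRe x" "qIm1 (r *\<^sub>R x) = r * qIm1 x"
  "qIm2 (r *\<^sub>R x) = r * qIm2 x" "qIm3 (r *\<^sub>R x) = r * qIm3 x"
  by (simp_all add: scaleR_quat_def)

lemma quat_sel_of_real [simp]:
  "qRe (of_real r) = r" "qIm1 (of_real r) = 0" "qIm2 (of_real r) = 0" "qIm3 (of_real r) = 0"
  by (simp_all add: of_real_def)

lemma quat_sum_squares_pos:
  "x \<noteq> 0 \<Longrightarrow> 0 < (qRe x)\<^sup>2 + (qIm1 x)\<^sup>2 + (qIm2 x)\<^sup>2 + (qIm3 x)\<^sup>2"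
proof -
  assume "x \<noteq> 0"
  then have "qRe x \<noteq> 0 \<or> qIm1 x \<noteq> 0 \<or> qIm2 x \<noteq> 0 \<or> qIm3 x \<noteq> 0"
    by (simp add: quat_eq_iff)
  then have "0 < (qRe x)\<^sup>2 \<or> 0 < (qIm1 x)\<^sup>2 \<or> 0 < (qIm2 x)\<^sup>2 \<or> 0 < (qIm3 x)\<^sup>2"
    by simp
  then show ?thesis
    using zero_le_power2[of "qRe x"] zero_le_power2[of "qIm1 x"]
      zero_le_power2[of "qIm2 x"] zero_le_power2[of "qIm3 x"] by linarith
qed

definition qcnj :: "quat \<Rightarrow> quat"
  where "qcnj q = Quat (qRe q) (- qIm1 q) (- qIm2 q) (- qIm3 q)"

lemma qcnj_sel [simp]:
  "qRe (qcnj q) = qRe q" "qIm1 (qcnj q) = - qIm1 q"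
  "qIm2 (qcnj q) = - qIm2 q" "qIm3 (qcnj q) = - qIm3 q"
  by (simp_all add: qcnj_def)

lemma quat_mult_qcnj:
  "q * qcnj q = of_real ((qRe q)\<^sup>2 + (qIm1 q)\<^sup>2 + (qIm2 q)\<^sup>2 + (qIm3 q)\<^sup>2)"
  "qcnj q * q = of_real ((qRe q)\<^sup>2 + (qIm1 q)\<^sup>2 + (qIm2 q)\<^sup>2 + (qIm3 q)\<^sup>2)"
  by (simp_all add: quat_eq_iff power2_eq_square)

instantiation quat :: real_div_algebra
begin

definition inverse_quat_def:
  "inverse q = inverse ((qRe q)\<^sup>2 + (qIm1 q)\<^sup>2 + (qIm2 q)\<^sup>2 + (qIm3 q)\<^sup>2) *\<^sub>R qcnj q"

definition divide_quat_def: "(x :: quat) div y = x * inverse y"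

instance
proof
  fix x y :: quat
  define s where "s = (qRe x)\<^sup>2 + (qIm1 x)\<^sup>2 + (qIm2 x)\<^sup>2 + (qIm3 x)\<^sup>2"
  have "inverse x * x = (inverse s * s) *\<^sub>R 1" "x * inverse x = (inverse s * s) *\<^sub>R 1"
    unfolding inverse_quat_def mult_scaleR_left mult_scaleR_right quat_mult_qcnj
      s_def [symmetric] by (simp_all add: of_real_def)
  moreover have "x \<noteq> 0 \<Longrightarrow> s > 0"
    unfolding s_def by (rule quat_sum_squares_pos)
  ultimately show "x \<noteq> 0 \<Longrightarrow> inverse x * x = 1" "x \<noteq> 0 \<Longrightarrow> x * inverse x = 1"
    by simp_all
  show "x div y = x * inverse y"
    by (rule divide_quat_def)
  show "inverse 0 = (0 :: quat)"
    by (simp add: inverse_quat_def quat_eq_iff)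
qed

end

instantiation quat :: real_normed_div_algebra
begin

definition norm_quat_def:
  "norm q = sqrt ((qRe q)\<^sup>2 + (qIm1 q)\<^sup>2 + (qIm2 q)\<^sup>2 + (qIm3 q)\<^sup>2)"

definition sgn_quat_def: "sgn (q :: quat) = q /\<^sub>R norm q"

definition dist_quat_def: "dist x (y :: quat) = norm (x - y)"

definition uniformity_quat_def:
  "(uniformity :: (quat \<times> quat) filter) = (INF e\<in>{0 <..}. principal {(x, y). dist x y < e})"

definition open_quat_def:
  "open (U :: quat set) \<longleftrightarrow> (\<forall>x\<in>U. eventually (\<lambda>(x', y). x' = x \<longrightarrow> y \<in> U) uniformity)"

instance
proof
  fix r :: real and x y :: quat and S :: "quat set"
  show "(norm x = 0) = (x = 0)"
  proof
    show "norm x = 0 \<Longrightarrow> x = 0"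
      using quat_sum_squares_pos[of x] by (force simp: norm_quat_def)
  qed (simp add: norm_quat_def)
  have *: "norm z = norm (Complex (qRe z) (qIm1 z), Complex (qIm2 z) (qIm3 z))" for z
    by (simp add: norm_quat_def norm_prod_def complex_norm add.assoc)
  show "norm (x + y) \<le> norm x + norm y"
    using norm_triangle_ineq[of "(Complex (qRe x) (qIm1 x), Complex (qIm2 x) (qIm3 x))"
        "(Complex (qRe y) (qIm1 y), Complex (qIm2 y) (qIm3 y))"]
    by (simp add: * complex_add)
  show "norm (r *\<^sub>R x) = \<bar>r\<bar> * norm x"
  proof -
    have "norm (r *\<^sub>R x) = sqrt (r\<^sup>2 * ((qRe x)\<^sup>2 + (qIm1 x)\<^sup>2 + (qIm2 x)\<^sup>2 + (qIm3 x)\<^sup>2))"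
      by (simp add: norm_quat_def power_mult_distrib distrib_left)
    then show ?thesis
      by (simp add: norm_quat_def real_sqrt_mult)
  qed
  show "norm (x * y) = norm x * norm y"
    unfolding norm_quat_def real_sqrt_mult [symmetric] quat_sel_mult
    by (rule arg_cong[where f = sqrt]) (simp add: power2_eq_square algebra_simps)
qed (rule sgn_quat_def dist_quat_def open_quat_def uniformity_quat_def)+

end

text \<open>The Euclidean structure makes \<^typ>\<open>quat\<close> a separable Banach space, so that the Bochner
  integral and the exponential series are available for quaternions.\<close>

instantiation quat :: euclidean_space
begin

definition inner_quat_def:
  "inner x y = qRe x * qRe y + qIm1 x * qIm1 y + qIm2 x * qIm2 y + qIm3 x * qIm3 y"

definition Basis_quat_def:
  "Basis = {Quat 1 0 0 0, Quat 0 1 0 0, Quat 0 0 1 0, Quat 0 0 0 1}"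

instance
proof
  fix x y z :: quat and r :: real
  show "inner x y = inner y x"
    by (simp add: inner_quat_def mult.commute)
  show "inner (x + y) z = inner x z + inner y z"
    by (simp add: inner_quat_def algebra_simps)
  show "inner (r *\<^sub>R x) y = r * inner x y"
    by (simp add: inner_quat_def algebra_simps)
  show "0 \<le> inner x x"
    by (simp add: inner_quat_def)
  show "inner x x = 0 \<longleftrightarrow> x = 0"
    using quat_sum_squares_pos[of x] by (force simp: inner_quat_def power2_eq_square)
  show "norm x = sqrt (inner x x)"
    by (simp add: inner_quat_def norm_quat_def power2_eq_square)
  show "(Basis :: quat set) \<noteq> {}" "finite (Basis :: quat set)"
    by (simp_all add: Basis_quat_def)
next
  fix u v :: quat
  assume "u \<in> Basis" "v \<in> Basis"
  then show "inner u v = (if u = v then 1 else 0)"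
    unfolding Basis_quat_def inner_quat_def by (elim insertE emptyE) simp_all
next
  fix x :: quat
  show "(\<forall>u\<in>Basis. inner x u = 0) \<longleftrightarrow> x = 0"
    by (simp add: Basis_quat_def inner_quat_def quat_eq_iff[of x 0])
qed

end

definition imag_unit_sphere :: "quat set"
  where "imag_unit_sphere = {q. q\<^sup>2 = - 1}"


section \<open>Square integrable quaternion-valued functions\<close>

definition L2_quat :: "(real \<Rightarrow> quat) set"
  where "L2_quat = {f \<in> borel_measurable lebesgue. integrable lebesgue (\<lambda>t. (norm (f t))\<^sup>2)}"

definition L2_quat_norm :: "(real \<Rightarrow> quat) \<Rightarrow> real"
  where "L2_quat_norm f = sqrt (\<integral>t. (norm (f t))\<^sup>2 \<partial>lebesgue)"


section \<open>The Segal--Bargmann transform and the short-time Fourier transform\<close>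

text \<open>The parameter is fixed to $\nu = 2\pi$. The values of \<open>f\<close> stand to the right of the kernel.\<close>

definition segal_bargmann :: "(real \<Rightarrow> quat) \<Rightarrow> quat \<Rightarrow> quat"
  where "segal_bargmann f q =
    (\<integral>t. of_real (2 powr (3/4)) *
          exp (- of_real pi * (q\<^sup>2 + of_real (t\<^sup>2)) + of_real (2 * pi * sqrt 2) * q * of_real t) *
          f t \<partial>lebesgue)"

text \<open>The transform with the Gaussian window $\varphi(t) = 2^{1/4} e^{-\pi t^2}$; the window is
  built into the formula, which is taken as the definition. The kernel constant $2^{3/4}$ makes
  this $\sqrt 2$ times the classical $\int f(t)\varphi(t-x)e^{-2\pi i\omega t}\,dt$.\<close>

definition qstft :: "quat \<Rightarrow> (real \<Rightarrow> quat) \<Rightarrow> real \<times> real \<Rightarrow> quat"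
  where "qstft I f = (\<lambda>(x, \<omega>).
    let q = of_real x + I * of_real \<omega>
    in exp (- I * of_real (pi * x * \<omega>)) * segal_bargmann f (qcnj q / of_real (sqrt 2)) *
       of_real (exp (- pi * (norm q)\<^sup>2 / 2)))"

end

theory Submission
  imports Defs "HOL-Probability.Distributions"
begin

text \<open>Since the constant $c_p$ is at most $1/2$ and the exponent $p/(p-2)$ exceeds $1$, it suffices
  to show $|U| \geq (1-\varepsilon)/2$, and this follows from the pointwise bound
  $|\mathcal{V}_\varphi f|^2 \leq 2$; no $L^p$ estimate is needed. For the pointwise bound,
  the quaternion exponentials lie in the copy of the complex numbers spanned by $1$ and $I$, so the
  kernel has modulus $2^{3/4} e^{-\pi(t-x)^2}$; a weighted AM-GM inequality then compares the
  integrand with a normal density and $|f|^2$, both of integral one.\<close>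

lemma imag_unit_sphere_iff:
  "I \<in> imag_unit_sphere \<longleftrightarrow> qRe I = 0 \<and> (qIm1 I)\<^sup>2 + (qIm2 I)\<^sup>2 + (qIm3 I)\<^sup>2 = 1"
proof
  assume "I \<in> imag_unit_sphere"
  then have "I * I = - 1"
    by (simp add: imag_unit_sphere_def power2_eq_square)
  then have re: "qRe I * qRe I - qIm1 I * qIm1 I - qIm2 I * qIm2 I - qIm3 I * qIm3 I = - 1"
    and im: "qRe I * qIm1 I = 0" "qRe I * qIm2 I = 0" "qRe I * qIm3 I = 0"
    by (auto simp: quat_eq_iff)
  have "qRe I = 0"
  proof (rule ccontr)
    assume "qRe I \<noteq> 0"
    with im re have "qRe I * qRe I = - 1" by simp
    then show False using zero_le_square[of "qRe I"] by linarith
  qed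
  with re show "qRe I = 0 \<and> (qIm1 I)\<^sup>2 + (qIm2 I)\<^sup>2 + (qIm3 I)\<^sup>2 = 1"
    by (simp add: power2_eq_square)
next
  assume "qRe I = 0 \<and> (qIm1 I)\<^sup>2 + (qIm2 I)\<^sup>2 + (qIm3 I)\<^sup>2 = 1"
  then show "I \<in> imag_unit_sphere"
    by (simp add: imag_unit_sphere_def power2_eq_square quat_eq_iff)
qed

text \<open>The embedding of the complex numbers that sends the imaginary unit to \<open>I\<close>.
  For \<open>I\<close> in the sphere it is an isometric homomorphism of real algebras, so exponents
  in \<open>q\<close> can be computed in a commutative field.\<close>

definition quat_of_complex :: "quat \<Rightarrow> complex \<Rightarrow> quat"
  where "quat_of_complex I z = of_real (Re z) + I * of_real (Im z)"

context
  fixes I :: quat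
  assumes I: "I \<in> imag_unit_sphere"
begin

lemma quat_of_complex_mult:
  "quat_of_complex I (w * z) = quat_of_complex I w * quat_of_complex I z"
proof -
  have "qRe I = 0" "qIm1 I * qIm1 I + qIm2 I * qIm2 I + qIm3 I * qIm3 I = 1"
    using I by (simp_all add: imag_unit_sphere_iff power2_eq_square)
  \<comment> \<open>This is |I|^2 = 1 multiplied by \<open>Im w * Im z\<close>, expanded as it
    occurs in the real component of the product.\<close>
  moreover from this(2) have "Im w * Im z = qIm1 I * Im w * (qIm1 I * Im z) + 
      qIm2 I * Im w * (qIm2 I * Im z) + qIm3 I * Im w * (qIm3 I * Im z)"
    by algebra
  ultimately show ?thesis
    by (simp add: quat_of_complex_def quat_eq_iff algebra_simps)
qed

lemma quat_of_complex_power: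
  "quat_of_complex I (z ^ n) = quat_of_complex I z ^ n"
  by (induction n) (simp_all add: quat_of_complex_mult, simp add: quat_of_complex_def)

lemma norm_quat_of_complex [simp]: "norm (quat_of_complex I z) = norm z"
proof -
  have "qRe I = 0" "(qIm1 I)\<^sup>2 + (qIm2 I)\<^sup>2 + (qIm3 I)\<^sup>2 = 1"
    using I by (simp_all add: imag_unit_sphere_iff)
  moreover from this(2) have "(Im z)\<^sup>2 = (qIm1 I * Im z)\<^sup>2 + (qIm2 I * Im z)\<^sup>2 + (qIm3 I * Im z)\<^sup>2"
    by algebra
  ultimately show ?thesis
    by (simp add: quat_of_complex_def norm_quat_def cmod_def)
qed

lemma bounded_linear_quat_of_complex: "bounded_linear (quat_of_complex I)"
  by (rule bounded_linear_intro[where K = 1])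
     (simp_all, simp_all add: quat_of_complex_def quat_eq_iff algebra_simps)

text \<open>A continuous algebra homomorphism passes through the exponential series term by
  term.\<close>

lemma exp_quat_of_complex: "exp (quat_of_complex I z) = quat_of_complex I (exp z)"
proof -
  interpret bounded_linear "quat_of_complex I"
    by (rule bounded_linear_quat_of_complex)
  show ?thesis
    unfolding exp_def suminf[OF summable_exp_generic]
    by (simp add: scaleR quat_of_complex_power)
qed

lemma norm_exp_quat_of_complex: "norm (exp (quat_of_complex I z)) = exp (Re z)"
  by (simp add: exp_quat_of_complex)

lemma norm_segal_bargmann_kernel:
  "norm (exp (- of_real pi * ((qcnj (of_real x + I * of_real \<omega>) / of_real (sqrt 2))\<^sup>2 + of_real (t\<^sup>2)) +
      of_real (2 * pi * sqrt 2) * (qcnj (of_real x + I * of_real \<omega>) / of_real (sqrt 2)) * of_real t))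
    = exp (- pi * ((x\<^sup>2 - \<omega>\<^sup>2) / 2 + t\<^sup>2) + 2 * pi * x * t)"
proof -
  interpret linear: bounded_linear "quat_of_complex I"
    by (rule bounded_linear_quat_of_complex)
  \<comment> \<open>Since \<open>I\<close> has real part 0, \<open>qcnj\<close> flips the sign of
    its coefficient, so z = (x - i\<omega>)/sqrt 2 and Re z^2 = (x^2 - \<omega>^2)/2.\<close>
  define z where "z = Complex (x / sqrt 2) (- \<omega> / sqrt 2)"
  have real: "of_real r = quat_of_complex I (of_real r)" for r
    by (simp add: quat_of_complex_def)
  have "qcnj (of_real x + I * of_real \<omega>) / of_real (sqrt 2) = quat_of_complex I z"
    using I by (simp add: imag_unit_sphere_iff quat_of_complex_def z_def quat_eq_iff
      divide_inverse flip: of_real_inverse)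
  then have "- of_real pi * ((qcnj (of_real x + I * of_real \<omega>) / of_real (sqrt 2))\<^sup>2 + of_real (t\<^sup>2)) +
      of_real (2 * pi * sqrt 2) * (qcnj (of_real x + I * of_real \<omega>) / of_real (sqrt 2)) * of_real t =
    quat_of_complex I (- of_real pi * (z\<^sup>2 + of_real (t\<^sup>2)) + of_real (2 * pi * sqrt 2) * z * of_real t)"
    (is "?l = quat_of_complex I ?r")
    unfolding real by (simp only: linear.add linear.neg quat_of_complex_mult quat_of_complex_power)
  moreover have "Re ?r = - pi * ((x\<^sup>2 - \<omega>\<^sup>2) / 2 + t\<^sup>2) + 2 * pi * x * t"
    by (simp add: z_def power2_eq_square field_simps)
  ultimately show ?thesis
    by (simp only: norm_exp_quat_of_complex)
qed

lemma norm_qstft_le: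
  assumes f: "f \<in> L2_quat" "L2_quat_norm f = 1"
  shows "norm (qstft I f (x, \<omega>)) \<le> sqrt 2"
proof -
  define q where "q = of_real x + I * of_real \<omega>"
  define E where "E t = exp (- of_real pi * ((qcnj q / of_real (sqrt 2))\<^sup>2 + of_real (t\<^sup>2)) +
      of_real (2 * pi * sqrt 2) * (qcnj q / of_real (sqrt 2)) * of_real t)" for t
  define c where "c = exp (- pi * (norm q)\<^sup>2 / 2)"
  \<comment> \<open>The square of the Gaussian window translated to \<open>x\<close>, which is a
    normal density of variance 1/(4 pi).\<close>
  define g where "g t = sqrt 2 * exp (- 2 * pi * (t - x)\<^sup>2)" for t
  have g_eq: "g = normal_density x (1 / (2 * sqrt pi))"
    by (rule ext) (simp add: g_def normal_density_def power_divide power_mult_distrib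
      real_sqrt_divide algebra_simps)
  have "integrable lborel g" "(\<integral>t. g t \<partial>lborel) = 1" and g_meas: "g \<in> borel_measurable lborel"
    unfolding g_eq by (simp_all add: integral_normal_density)
  \<comment> \<open>The density facts live on \<open>lborel\<close>; passing to the completion
    changes neither integrability nor the integral.\<close>
  then have g: "integrable lebesgue g" "(\<integral>t. g t \<partial>lebesgue) = 1"
    by (simp_all add: integrable_completion integral_completion)
  have f_int: "integrable lebesgue (\<lambda>t. (norm (f t))\<^sup>2)" "(\<integral>t. (norm (f t))\<^sup>2 \<partial>lebesgue) = 1"
    using f by (simp_all add: L2_quat_def L2_quat_norm_def)
  have q_norm: "(norm q)\<^sup>2 = x\<^sup>2 + \<omega>\<^sup>2"
    using norm_quat_of_complex[of "Complex x \<omega>"]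
    by (simp add: q_def quat_of_complex_def cmod_def)
  have phase: "norm (exp (- I * of_real (pi * x * \<omega>))) = 1"
    using norm_exp_quat_of_complex[of "Complex 0 (- (pi * x * \<omega>))"]
    by (simp add: quat_of_complex_def)
  have "sqrt 2 = (2::real) powr (1/2)"
    by (simp add: powr_half_sqrt)
  then have two: "(2 powr (3/4))\<^sup>2 = 2 * sqrt (2::real)"
    by (simp add: power2_eq_square flip: powr_add)
       (use powr_add[of "2::real" 1 "1/2"] in simp)
  have bound: "c * norm (of_real (2 powr (3/4)) * E t * f t) \<le> (g t + (norm (f t))\<^sup>2) / sqrt 2" for t
  proof -
    define e where "e = exp (- pi * (t - x)\<^sup>2)"
    \<comment> \<open>The factor \<open>c\<close> contributes -pi (x^2 + \<omega>^2)/2 to the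
      exponent: the \<omega>^2 terms cancel and the rest completes the square.\<close>
    have "c * norm (E t) = e"
      unfolding E_def q_def norm_segal_bargmann_kernel c_def q_norm[unfolded q_def] e_def
      by (simp add: power2_eq_square field_simps flip: exp_add)
    then have "c * norm (of_real (2 powr (3/4)) * E t * f t) = 2 powr (3/4) * e * norm (f t)"
      by (simp add: norm_mult mult_ac)
    \<comment> \<open>Here 2ab \<le> a^2 + b^2 with a = 2^(1/4) e, the translated window itself, so
      that a^2 = \<open>g t\<close>; the surplus sqrt 2 in the kernel is divided out at the
      end.\<close>
    moreover have "2 * (2 powr (3/4) * e / sqrt 2 * norm (f t)) \<le> (2 powr (3/4) * e / sqrt 2)\<^sup>2 + (norm (f t))\<^sup>2"
      using sum_squares_bound[of "2 powr (3/4) * e / sqrt 2" "norm (f t)"] by (simp add: mult_ac)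
    moreover have "(2 powr (3/4) * e / sqrt 2)\<^sup>2 = g t"
      by (simp add: power_mult_distrib power_divide two e_def g_def flip: exp_double)
    moreover have "2 * (2 powr (3/4) * e / sqrt 2 * norm (f t)) = sqrt 2 * (2 powr (3/4) * e * norm (f t))"
      by (simp add: real_div_sqrt field_simps)
    ultimately have "sqrt 2 * (c * norm (of_real (2 powr (3/4)) * E t * f t)) \<le> g t + (norm (f t))\<^sup>2"
      by simp
    then show ?thesis
      by (simp add: pos_le_divide_eq mult.commute)
  qed
  have "norm (qstft I f (x, \<omega>)) = c * norm (segal_bargmann f (qcnj q / of_real (sqrt 2)))"
    using phase by (simp add: qstft_def Let_def norm_mult q_def c_def)
  \<comment> \<open>A non-integrable function has integral 0 by convention, so this bound holds for
    every integrand, and the comparison below rests on an integrable, nonnegative majorant.\<close>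
  also have "\<dots> \<le> c * (\<integral>t. norm (of_real (2 powr (3/4)) * E t * f t) \<partial>lebesgue)"
    unfolding segal_bargmann_def E_def
    by (intro mult_left_mono integral_norm_bound) (simp add: c_def)
  also have "\<dots> = (\<integral>t. c * norm (of_real (2 powr (3/4)) * E t * f t) \<partial>lebesgue)"
    by simp
  also have "\<dots> \<le> (\<integral>t. (g t + (norm (f t))\<^sup>2) / sqrt 2 \<partial>lebesgue)"
    using g f_int bound by (intro integral_mono') (auto simp: g_eq)
  also have "\<dots> = 2 / sqrt 2"
    using g f_int by simp
  finally show ?thesis
    by (simp add: real_div_sqrt)
qed

end

text \<open>After taking logarithms the claim is ln p \<le> (p/2 + 2) ln 2. The tangent to ln at 4
  gives ln p \<le> 2 ln 2 + p/4 - 1, and ln 2 \<ge> 2/3 gives (p/2) ln 2 \<ge> p/3.\<close>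

lemma constant_le_half:
  assumes "2 < (p::real)"
  shows "(2 powr (p + 1) / p) powr (- (2 / (p - 2))) \<le> 1 / 2"
proof -
  define b where "b = 2 powr (p + 1) / p"
  have "ln (p / 4) \<le> p / 4 - 1"
    using assms by (intro ln_le_minus_one) simp
  then have "ln p - 2 * ln 2 \<le> p / 4 - 1"
    using assms ln_realpow[of "2::real" 2] by (simp add: ln_div)
  moreover have "p * (2 / 3) \<le> p * ln 2"
    using assms ln2_ge_two_thirds by (intro mult_left_mono) auto
  moreover have "ln b = p * ln 2 + ln 2 - ln p"
    using assms by (simp add: b_def ln_div ln_powr algebra_simps)
  ultimately have "p * ln 2 / 2 - ln 2 \<le> ln b"
    using assms ln2_ge_two_thirds by linarith
  then have "ln 2 \<le> 2 / (p - 2) * ln b"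
    using assms by (simp add: field_simps)
  then have "- (2 / (p - 2)) * ln b \<le> - ln 2"
    by simp
  moreover have "b \<noteq> 0"
    using assms by (simp add: b_def)
  ultimately have "b powr (- (2 / (p - 2))) \<le> exp (- ln 2)"
    unfolding powr_def by simp
  then show ?thesis
    by (simp add: b_def exp_minus)
qed

theorem theorem5p15:
  fixes I :: quat and p \<epsilon> :: real and f :: "real \<Rightarrow> quat" and U :: "(real \<times> real) set"
  assumes "I \<in> imag_unit_sphere"
    and "2 < p"
    and "f \<in> L2_quat" and "L2_quat_norm f = 1"
    and "open U"
    and "0 \<le> \<epsilon>" and "\<epsilon> \<le> 1"
    and "(\<integral>\<^sup>+ z \<in> U. ennreal ((norm (qstft I f z))\<^sup>2) \<partial>lebesgue) \<ge> ennreal (1 - \<epsilon>)"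
  shows "emeasure lebesgue U \<ge>
    ennreal ((2 powr (p + 1) / p) powr (- (2 / (p - 2))) * (1 - \<epsilon>) powr (p / (p - 2)))"
proof -
  have le2: "(norm (qstft I f z))\<^sup>2 \<le> 2" for z
    using power_mono[OF norm_qstft_le[OF assms(1,3,4)], of "fst z" "snd z" 2] by simp
  have "ennreal (1 - \<epsilon>) \<le> (\<integral>\<^sup>+ z \<in> U. ennreal ((norm (qstft I f z))\<^sup>2) \<partial>lebesgue)"
    by (rule assms(8))
  \<comment> \<open>The mass on \<open>U\<close> is at most the supremum of the integrand times the
    measure of \<open>U\<close>.\<close>
  also have "\<dots> \<le> (\<integral>\<^sup>+ z. 2 * indicator U z \<partial>lebesgue)"
    using le2 by (intro nn_integral_mono) (auto simp: indicator_def ennreal_le_iff2 simp flip: ennreal_numeral)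
  also have "\<dots> = 2 * emeasure lebesgue U"
    using assms(5) by (simp add: nn_integral_cmult_indicator borel_open)
  finally have main: "ennreal (1 - \<epsilon>) \<le> 2 * emeasure lebesgue U" .
  \<comment> \<open>The base lies in [0,1] and p/(p-2) \<ge> 1, so the power is at most the
    base.\<close>
  have "(1 - \<epsilon>) powr (p / (p - 2)) \<le> (1 - \<epsilon>) powr 1"
    using assms by (intro powr_mono') (auto simp: field_simps)
  then have "(2 powr (p + 1) / p) powr (- (2 / (p - 2))) * (1 - \<epsilon>) powr (p / (p - 2)) \<le> 1 / 2 * (1 - \<epsilon>)"
    using assms(6,7) by (intro mult_mono constant_le_half assms(2)) simp_all
  then have "ennreal ((2 powr (p + 1) / p) powr (- (2 / (p - 2))) * (1 - \<epsilon>) powr (p / (p - 2)))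
      \<le> ennreal (1 / 2 * (1 - \<epsilon>))"
    by (rule ennreal_leI)
  also have "\<dots> \<le> emeasure lebesgue U"
  \<comment> \<open>Infinite measure is trivial; for finite measure \<open>main\<close> becomes an
    inequality of reals that can be halved.\<close>
  proof (cases "emeasure lebesgue U")
    case (real r)
    have "2 * ennreal r = ennreal (2 * r)"
      using real by (simp add: ennreal_mult)
    with main real show ?thesis
      using assms(6,7) by (simp add: ennreal_le_iff)
  qed simp
  finally show ?thesis .
qed

end
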